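(* Let $S$ be a von Neumann regular semiring. Then the classes of $k$-prime ideals and $k$-primary ideals of $S$ coincide; that is, a $k$-ideal of $S$ is $k$-prime if and only if it is $k$-primary.
   Context: A semiring is a commutative semiring $(S,+,0,\cdot,1)$ with multiplicative identity $1$ and additive identity $0$ that is absorbing. $S$ is von Neumann regular if for every $a\in S$ there is $x\in S$ with $a=a^2x$. An ideal is a nonempty subset closed under addition and under multiplication by elements of $S$. A $k$-ideal is an ideal $I$ such that $x+y\in I$ and $y\in I$ imply $x\in I$. A $k$-ideal $I$ is $k$-prime if for all $k$-ideals $A,B$ of $S$, $AB\subseteq I$ implies $A\subseteq I$ or $B\subseteq I$, where $AB$ is the ideal of finite sums of products $ab$ with $a\in A$, $b\in B$. A $k$-ideal $I$ is $k$-primary if $ab\in I$ and $a\notin I$ imply $b^n\in I$ for some natural number $n\geq 1$. *)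

theory Defs
  imports Main
begin

(* A commutative semiring with 0 and 1 is a type of sort {comm_semiring_0, comm_monoid_mult}.
   This is comm_semiring_1 without the axiom 0 \<noteq> 1, so the trivial semiring is included. *)

definition von_neumann_regular :: "'a::{comm_semiring_0, comm_monoid_mult} itself \<Rightarrow> bool" where
  "von_neumann_regular _ \<longleftrightarrow> (\<forall>a::'a. \<exists>x. a = a ^ 2 * x)"

definition semiring_ideal :: "'a::{comm_semiring_0, comm_monoid_mult} set \<Rightarrow> bool" where
  "semiring_ideal I \<longleftrightarrow>
     I \<noteq> {} \<and> (\<forall>x\<in>I. \<forall>y\<in>I. x + y \<in> I) \<and> (\<forall>s. \<forall>x\<in>I. s * x \<in> I)"

definition k_ideal :: "'a::{comm_semiring_0, comm_monoid_mult} set \<Rightarrow> bool" where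
  "k_ideal I \<longleftrightarrow> semiring_ideal I \<and> (\<forall>x y. x + y \<in> I \<and> y \<in> I \<longrightarrow> x \<in> I)"

(* The empty sum (n = 0) is allowed; it only contributes 0, which lies in every ideal. *)
definition ideal_product ::
    "'a::{comm_semiring_0, comm_monoid_mult} set \<Rightarrow> 'a set \<Rightarrow> 'a set" where
  "ideal_product A B =
     {\<Sum>i<n. a i * b i | (n::nat) a b. \<forall>i<n. a i \<in> A \<and> b i \<in> B}"

(* Neither k_prime nor k_primary requires I to be proper: the whole semiring satisfies both. *)

definition k_prime :: "'a::{comm_semiring_0, comm_monoid_mult} set \<Rightarrow> bool" where
  "k_prime I \<longleftrightarrow> k_ideal I \<and>
     (\<forall>A B. k_ideal A \<and> k_ideal B \<and> ideal_product A B \<subseteq> I \<longrightarrow> A \<subseteq> I \<or> B \<subseteq> I)"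

definition k_primary :: "'a::{comm_semiring_0, comm_monoid_mult} set \<Rightarrow> bool" where
  "k_primary I \<longleftrightarrow> k_ideal I \<and>
     (\<forall>a b. a * b \<in> I \<and> a \<notin> I \<longrightarrow> (\<exists>n\<ge>1. b ^ n \<in> I))"

end

theory Submission
  imports Defs
begin

text \<open>
  If \<open>a * b \<in> I\<close> with \<open>I\<close> k-prime, then the annihilator \<open>A\<close> of \<open>b\<close> modulo \<open>I\<close> and the annihilator
  \<open>B\<close> of \<open>A\<close> modulo \<open>I\<close> are k-ideals with \<open>A B \<subseteq> I\<close>, \<open>a \<in> A\<close> and \<open>b \<in> B\<close>, so \<open>a \<in> I\<close> or \<open>b \<in> I\<close>;
  this replaces the usual k-closures of principal ideals.
  Conversely, regularity gives \<open>b = b ^ n * (b * x ^ n)\<close>, so k-ideals are radical and a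
  k-primary ideal is completely prime.
\<close>

lemma k_ideal_zero: "k_ideal I \<Longrightarrow> 0 \<in> I"
  unfolding k_ideal_def semiring_ideal_def by (metis all_not_in_conv mult_zero_left)

lemma k_ideal_add: "k_ideal I \<Longrightarrow> x \<in> I \<Longrightarrow> y \<in> I \<Longrightarrow> x + y \<in> I"
  unfolding k_ideal_def semiring_ideal_def by blast

lemma k_ideal_mult_left: "k_ideal I \<Longrightarrow> x \<in> I \<Longrightarrow> s * x \<in> I"
  unfolding k_ideal_def semiring_ideal_def by blast

lemma k_ideal_subtractive: "k_ideal I \<Longrightarrow> x + y \<in> I \<Longrightarrow> y \<in> I \<Longrightarrow> x \<in> I"
  unfolding k_ideal_def by blast

lemma k_ideal_sum:
  assumes "k_ideal I" "\<And>i. i \<in> X \<Longrightarrow> f i \<in> I"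
  shows "sum f X \<in> I"
  using assms(2)
  \<comment> \<open>For infinite \<open>X\<close> the sum is 0 by convention, which also lies in
    \<open>I\<close>.\<close>
  by (induction X rule: infinite_finite_induct)
    (auto intro: k_ideal_zero[OF assms(1)] k_ideal_add[OF assms(1)])

text \<open>This is the colon ideal (I : C). Since (x + y)c = xc + yc, subtractivity passes from
  \<open>I\<close> to it, for an arbitrary set \<open>C\<close>.\<close>

lemma k_ideal_colon:
  assumes I: "k_ideal I"
  shows "k_ideal {x. \<forall>c\<in>C. x * c \<in> I}"
proof -
  have "\<forall>c\<in>C. 0 * c \<in> I"
    by (simp add: k_ideal_zero[OF I])
  then have "\<exists>x. \<forall>c\<in>C. x * c \<in> I"
    by blast
  then show ?thesis
    unfolding k_ideal_def semiring_ideal_def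
    by (auto simp: distrib_right mult.assoc
        intro: k_ideal_add[OF I] k_ideal_mult_left[OF I] k_ideal_subtractive[OF I])
qed

lemma mult_in_ideal_product:
  assumes "a \<in> A" "b \<in> B"
  shows "a * b \<in> ideal_product A B"
  unfolding ideal_product_def mem_Collect_eq
  by (rule exI[of _ 1], rule exI[of _ "\<lambda>_. a"], rule exI[of _ "\<lambda>_. b"])
    (use assms in simp)

lemma ideal_product_subset:
  assumes "k_ideal I" "\<And>a b. a \<in> A \<Longrightarrow> b \<in> B \<Longrightarrow> a * b \<in> I"
  shows "ideal_product A B \<subseteq> I"
  unfolding ideal_product_def by (auto intro!: k_ideal_sum[OF assms(1)] assms(2))

lemma k_prime_imp_completely_prime:
  assumes "k_prime I" "a * b \<in> I"
  shows "a \<in> I \<or> b \<in> I"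
proof -
  have I: "k_ideal I"
    using assms(1) by (simp add: k_prime_def)
  \<comment> \<open>The singleton puts \<open>A\<close> in the form (I : C), so that one lemma
    covers both \<open>A\<close> and \<open>B\<close>.\<close>
  define A where "A = {x. \<forall>c\<in>{b}. x * c \<in> I}"
  define B where "B = {y. \<forall>c\<in>A. y * c \<in> I}"
  have "k_ideal A" "k_ideal B"
    unfolding A_def B_def by (rule k_ideal_colon[OF I])+
  moreover have "ideal_product A B \<subseteq> I"
    by (rule ideal_product_subset[OF I]) (auto simp: B_def mult.commute)
  ultimately have "A \<subseteq> I \<or> B \<subseteq> I"
    using assms(1) unfolding k_prime_def by blast
  moreover have "a \<in> A" "b \<in> B"
    using assms(2) by (auto simp: A_def B_def mult.commute)
  ultimately show ?thesis
    by blast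
qed

lemma von_neumann_regular_power:
  fixes b x :: "'a::comm_monoid_mult"
  assumes "b = b ^ 2 * x"
  shows "b = b ^ n * (b * x ^ n)"
proof (induction n)
  case (Suc n)
  \<comment> \<open>Regrouping isolates a factor \<open>b ^ 2 * x\<close>, which collapses to
    \<open>b\<close> and leaves the case \<open>n\<close>.\<close>
  have "b ^ Suc n * (b * x ^ Suc n) = b ^ n * ((b ^ 2 * x) * x ^ n)"
    by (simp add: power2_eq_square ac_simps)
  with Suc assms show ?case
    by simp
qed simp

lemma k_ideal_radical:
  fixes b :: "'a::{comm_semiring_0, comm_monoid_mult}"
  assumes "von_neumann_regular TYPE('a)" "k_ideal I" "b ^ n \<in> I"
  shows "b \<in> I"
proof -
  obtain x where "b = b ^ 2 * x"
    using assms(1) unfolding von_neumann_regular_def by blast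
  then have "b = (b * x ^ n) * b ^ n"
    using von_neumann_regular_power[of b x n] by (simp add: mult.commute)
  then show ?thesis
    using k_ideal_mult_left[OF assms(2,3)] by metis
qed

theorem theorem3p9:
  assumes "von_neumann_regular TYPE('a::{comm_semiring_0, comm_monoid_mult})"
  shows "{I :: 'a set. k_prime I} = {I. k_primary I}"
proof (intro Collect_cong iffI)
  fix I :: "'a set"
  assume prime: "k_prime I"
  show "k_primary I"
    unfolding k_primary_def
  proof (intro conjI allI impI)
    show "k_ideal I"
      using prime by (simp add: k_prime_def)
    fix a b
    assume "a * b \<in> I \<and> a \<notin> I"
    then have "b ^ 1 \<in> I"
      using k_prime_imp_completely_prime[OF prime] by auto
    then show "\<exists>n\<ge>1. b ^ n \<in> I"
      by blast
  qed
next
  fix I :: "'a set"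
  assume primary: "k_primary I"
  then have I: "k_ideal I"
    by (simp add: k_primary_def)
  have "b \<in> I" if "a * b \<in> I" "a \<notin> I" for a b
    using primary that k_ideal_radical[OF assms I] unfolding k_primary_def by blast
  then show "k_prime I"
    \<comment> \<open>If neither \<open>A\<close> nor \<open>B\<close> lay in \<open>I\<close>,
      elements a of \<open>A\<close> and b of \<open>B\<close> outside \<open>I\<close> would have
      their product in \<open>I\<close>, against the previous fact.\<close>
    unfolding k_prime_def using I mult_in_ideal_product by blast
qed

end
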